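(* Let $\Delta_3 \in \mathbb{Z}_{>0}$ be a fixed parameter and let $r_{3,1}, r_{3,2} \in \mathbb{Z}_{>0}$ be fixed integers that are divisors of $\Delta_3$. Define the functions $$C(r_{3,1}) = \frac{-3 r_{3,1}^2 \pm \sqrt{12 \Delta_3 \cdot r_{3,1} - 3 r_{3,1}^4}}{6 \cdot r_{3,1}}, \qquad A(r_{3,1})^3 = C(r_{3,1})^3 + \Delta_3,$$ $$B(r_{3,2}) = \frac{-3 r_{3,2}^2 \pm \sqrt{12 \Delta_3 \cdot r_{3,2} - 3 r_{3,2}^4}}{6 \cdot r_{3,2}}, \qquad D(r_{3,2})^3 = B(r_{3,2})^3 + \Delta_3.$$ Alternatively, define the functions of $c_1$ $$C(c_1) = \frac{-6 + (15 - 7\sqrt{3})(7 - 4\sqrt{3})^{c_1} + (15 + 7\sqrt{3})(7 + 4\sqrt{3})^{c_1}}{4},$$ $$B(c_1) = \frac{-18 + (7 - 5\sqrt{3})(7 - 4\sqrt{3})^{c_1} + (7 + 5\sqrt{3})(7 + 4\sqrt{3})^{c_1}}{4},$$ $$A(c_1) = C(c_1) + 3, \qquad D(c_1) = B(c_1) + 9.$$ Then for all $c_1 \in \mathbb{Z}_{\ge 0}$, the values $A(c_1), B(c_1), C(c_1), D(c_1)$ are integers, and they satisfy the identity $$A(c_1)^3 + B(c_1)^3 = C(c_1)^3 + D(c_1)^3.$$ *)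

theory Defs
  imports Complex_Main
begin

text \<open>
  The roots in \<open>x\<close> of \<open>(x + r)\<^sup>3 = x\<^sup>3 + \<Delta>\<close>, by the quadratic formula. The sign
  \<open>s \<in> {1, -1}\<close> stands for the choice of \<open>\<plusminus>\<close>. The values are complex because
  \<open>12 \<Delta> r - 3 r^4\<close> may be negative; where it is not, \<open>csqrt\<close> is the usual real root.
\<close>
definition div_root :: "int \<Rightarrow> complex \<Rightarrow> int \<Rightarrow> complex" where
  "div_root \<Delta> s r =
     (- 3 * of_int r ^ 2 + s * csqrt (12 * of_int \<Delta> * of_int r - 3 * of_int r ^ 4))
       / (6 * of_int r)"

definition C_seq :: "nat \<Rightarrow> real" where
  "C_seq c = (- 6 + (15 - 7 * sqrt 3) * (7 - 4 * sqrt 3) ^ c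
                  + (15 + 7 * sqrt 3) * (7 + 4 * sqrt 3) ^ c) / 4"

definition B_seq :: "nat \<Rightarrow> real" where
  "B_seq c = (- 18 + (7 - 5 * sqrt 3) * (7 - 4 * sqrt 3) ^ c
                   + (7 + 5 * sqrt 3) * (7 + 4 * sqrt 3) ^ c) / 4"

definition A_seq :: "nat \<Rightarrow> real" where
  "A_seq c = C_seq c + 3"

definition D_seq :: "nat \<Rightarrow> real" where
  "D_seq c = B_seq c + 9"

end

theory Submission
  imports Defs
begin

text \<open>
  Since \<open>A = C + 3\<close> and \<open>D = B + 9\<close>, the leading cubes cancel in \<open>A\<^sup>3 - C\<^sup>3\<close> and \<open>D\<^sup>3 - B\<^sup>3\<close>, so
  the identity is a quadratic equation in \<open>B\<close> and \<open>C\<close>. In terms of \<open>X = 2C + 3\<close> and \<open>Y = 2B + 9\<close>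
  it is the Pell-type equation \<open>X\<^sup>2 - 3Y\<^sup>2 = 78\<close>. The closed forms say that
  \<open>X + Y\<surd>3 = (15 + 7\<surd>3)(7 + 4\<surd>3)\<^sup>c\<close>: they run through the orbit of the solution \<open>(15, 7)\<close> under
  the unit \<open>7 + 4\<surd>3\<close>, whose norm is \<open>49 - 48 = 1\<close>.

  Multiplication by this unit sends \<open>(X, Y)\<close> to \<open>(7X + 12Y, 4X + 7Y)\<close>. This keeps both coordinates
  odd, so \<open>B\<close> and \<open>C\<close> stay integers, and it preserves the norm form. Both facts become inductions
  on \<open>c\<close> once the step is written as an integral affine recurrence for \<open>B\<close> and \<open>C\<close> (\<open>C_seq_Suc\<close>,
  \<open>B_seq_Suc\<close>).
\<close>

lemma B_seq_0: "B_seq 0 = - 1"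
  by (simp add: B_seq_def)

lemma C_seq_0: "C_seq 0 = 6"
  by (simp add: C_seq_def)

lemma sqrt_3_mult_sqrt_3_mult: "sqrt 3 * (sqrt 3 * x) = 3 * x"
  by (simp add: mult.assoc [symmetric])

text \<open>
  The next two recurrences are \<open>X' = 7X + 12Y\<close> and \<open>Y' = 4X + 7Y\<close> in the coordinates
  \<open>C = (X - 3)/2\<close> and \<open>B = (Y - 9)/2\<close>. That \<open>X\<close> and \<open>Y\<close> remain odd is visible in the constant terms
  \<open>63\<close> and \<open>33\<close> being integers.
\<close>

lemma C_seq_Suc: "C_seq (Suc c) = 7 * C_seq c + 12 * B_seq c + 63"
  by (simp add: C_seq_def B_seq_def sqrt_3_mult_sqrt_3_mult field_simps)

lemma B_seq_Suc: "B_seq (Suc c) = 4 * C_seq c + 7 * B_seq c + 33"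
  by (simp add: C_seq_def B_seq_def sqrt_3_mult_sqrt_3_mult field_simps)

lemma B_seq_C_seq_Ints: "B_seq c \<in> \<int> \<and> C_seq c \<in> \<int>"
  by (induction c) (auto simp: B_seq_0 C_seq_0 B_seq_Suc C_seq_Suc)

text \<open>The norm form \<open>X\<^sup>2 - 3Y\<^sup>2\<close> is invariant because \<open>7 + 4\<surd>3\<close> has norm \<open>1\<close>.\<close>

lemma seq_Pell: "(2 * C_seq c + 3)\<^sup>2 - 3 * (2 * B_seq c + 9)\<^sup>2 = 78"
proof (induction c)
  case 0
  show ?case by (simp add: B_seq_0 C_seq_0)
next
  case (Suc c)
  have "(2 * C_seq (Suc c) + 3)\<^sup>2 - 3 * (2 * B_seq (Suc c) + 9)\<^sup>2
      = (2 * C_seq c + 3)\<^sup>2 - 3 * (2 * B_seq c + 9)\<^sup>2"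
    unfolding B_seq_Suc C_seq_Suc by algebra
  with Suc.IH show ?case by simp
qed

text \<open>
  Substituting \<open>x = (X - 3)/2\<close> and \<open>y = (Y - 9)/2\<close> turns the difference of the two sides into
  \<open>9/4\<close> times \<open>X\<^sup>2 - 3Y\<^sup>2 - 78\<close>.
\<close>

lemma Pell_imp_cubes_eq:
  fixes x y :: real
  assumes "(2 * x + 3)\<^sup>2 - 3 * (2 * y + 9)\<^sup>2 = 78"
  shows "(x + 3) ^ 3 + y ^ 3 = x ^ 3 + (y + 9) ^ 3"
proof -
  have "4 * ((x + 3) ^ 3 + y ^ 3 - (x ^ 3 + (y + 9) ^ 3))
      = 9 * ((2 * x + 3)\<^sup>2 - 3 * (2 * y + 9)\<^sup>2 - 78)"
    by algebra
  with assms show ?thesis by simp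
qed

theorem theorem3p1:
  fixes \<Delta>3 r31 r32 :: int
    and s t :: complex
    and A B C D :: "int \<Rightarrow> complex"
  assumes "\<Delta>3 > 0"
    and "r31 > 0" and "r31 dvd \<Delta>3"
    and "r32 > 0" and "r32 dvd \<Delta>3"
    and "s \<in> {1, -1}" and "t \<in> {1, -1}"
    and "C r31 = div_root \<Delta>3 s r31"
    and "A r31 ^ 3 = C r31 ^ 3 + of_int \<Delta>3"
    and "B r32 = div_root \<Delta>3 t r32"
    and "D r32 ^ 3 = B r32 ^ 3 + of_int \<Delta>3"
  shows "\<forall>c1 :: nat.
           A_seq c1 \<in> \<int> \<and> B_seq c1 \<in> \<int> \<and> C_seq c1 \<in> \<int> \<and> D_seq c1 \<in> \<int> \<and>
           A_seq c1 ^ 3 + B_seq c1 ^ 3 = C_seq c1 ^ 3 + D_seq c1 ^ 3"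
  using B_seq_C_seq_Ints Pell_imp_cubes_eq [OF seq_Pell]
  by (auto simp: A_seq_def D_seq_def)

end
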